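(* In the worst violated constraint model, there is an algorithm which, given oracle access to a hidden WIDESAT instance on $n$ variables and $m$ distinct clauses, where $m\le n$, learns an equivalent instance (i.e. outputs a SAT formula with exactly the same satisfying assignments in $\{0,1\}^n$ as the hidden one) in $O\!\left(\binom{n}{m-1}2^{m}+n\right)$ time.
   Context: A SAT formula on Boolean variables $x_1,\dots,x_n$ is a conjunction of clauses $C_1,\dots,C_m$, each a disjunction of literals ($x_i$ or $\overline{x}_i$) on pairwise distinct variables. A WIDESAT clause is a clause containing all $n$ distinct variables (each one either positively or negated); a WIDESAT instance is a formula all of whose clauses are WIDESAT clauses. Worst violated constraint model: the formula is hidden and is accessed only through an oracle. A query is a probabilistic assignment $\mathbf{a}:[n]\to[0,1]$, meaning that independently $\Pr[x_i=1]=\mathbf{a}(i)$ and $\Pr[\overline{x}_i=1]=1-\mathbf{a}(i)$. The violation probability of a clause $C_j$ with literal set $T(C_j)$ is $\Pr[C_j=0]=\prod_{\ell\in T(C_j)}\Pr[\ell=0]$. If all clauses have violation probability $0$, the oracle reports that the formula is satisfied; otherwise it returns the index $j$ of a clause with the highest violation probability, breaking ties arbitrarily (possibly adversarially). Running time is total running time, with each oracle query costing unit time. *)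

theory Defs
  imports Complex_Main
begin

section \<open>Formulas\<close>

datatype literal = Pos (var: nat) | Neg (var: nat)

type_synonym clause = "literal set"
type_synonym formula = "clause list"

fun lit_true :: "(nat \<Rightarrow> bool) \<Rightarrow> literal \<Rightarrow> bool" where
  "lit_true x (Pos i) \<longleftrightarrow> x i"
| "lit_true x (Neg i) \<longleftrightarrow> \<not> x i"

definition satisfies :: "(nat \<Rightarrow> bool) \<Rightarrow> formula \<Rightarrow> bool" where
  "satisfies x F \<longleftrightarrow> (\<forall>c\<in>set F. \<exists>l\<in>c. lit_true x l)"

text \<open>The variables are \<open>1, \<dots>, n\<close>; injectivity of \<^const>\<open>var\<close> says that the
  literals of a clause are on pairwise distinct variables.\<close>

definition sat_clause :: "nat \<Rightarrow> clause \<Rightarrow> bool" where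
  "sat_clause n c \<longleftrightarrow> var ` c \<subseteq> {1..n} \<and> inj_on var c"

definition sat_formula :: "nat \<Rightarrow> formula \<Rightarrow> bool" where
  "sat_formula n F \<longleftrightarrow> (\<forall>c\<in>set F. sat_clause n c)"

definition wide_clause :: "nat \<Rightarrow> clause \<Rightarrow> bool" where
  "wide_clause n c \<longleftrightarrow> sat_clause n c \<and> var ` c = {1..n}"

definition widesat :: "nat \<Rightarrow> formula \<Rightarrow> bool" where
  "widesat n F \<longleftrightarrow> (\<forall>c\<in>set F. wide_clause n c)"

text \<open>The truth of a formula over \<open>1, \<dots>, n\<close> depends only on \<open>x 1, \<dots>, x n\<close>, so total
  functions \<open>x\<close> may stand for the elements of \<open>{0,1}\<close> to the power \<open>n\<close>.\<close>

definition equivalent :: "formula \<Rightarrow> formula \<Rightarrow> bool" where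
  "equivalent F G \<longleftrightarrow> (\<forall>x. satisfies x F \<longleftrightarrow> satisfies x G)"


section \<open>The worst violated constraint oracle\<close>

definition prob_assignment :: "nat \<Rightarrow> (nat \<Rightarrow> real) \<Rightarrow> bool" where
  "prob_assignment n a \<longleftrightarrow> (\<forall>i\<in>{1..n}. 0 \<le> a i \<and> a i \<le> 1)"

fun prob_false :: "(nat \<Rightarrow> real) \<Rightarrow> literal \<Rightarrow> real" where
  "prob_false a (Pos i) = 1 - a i"
| "prob_false a (Neg i) = a i"

definition violation_prob :: "(nat \<Rightarrow> real) \<Rightarrow> clause \<Rightarrow> real" where
  "violation_prob a c = (\<Prod>l\<in>c. prob_false a l)"

text \<open>The answer \<open>0\<close> reports that the formula is satisfied; the answer \<open>j \<ge> 1\<close> names the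
  \<open>j\<close>-th clause. This is a relation because ties are broken arbitrarily.\<close>

definition oracle_answer :: "formula \<Rightarrow> (nat \<Rightarrow> real) \<Rightarrow> nat \<Rightarrow> bool" where
  "oracle_answer F a j \<longleftrightarrow>
     (if \<forall>c\<in>set F. violation_prob a c = 0 then j = 0
      else j \<in> {1..length F} \<and>
           (\<forall>c\<in>set F. violation_prob a c \<le> violation_prob a (F ! (j - 1))))"


section \<open>Algorithms: random access machines with oracle access\<close>

text \<open>A unit-cost random access machine over the natural numbers, with addition, truncated
  subtraction and indirect addressing. Besides its memory it has a query array holding the
  current assignment, which is written one entry at a time and keeps its contents across
  queries, and a write-only output, which is written one literal at a time. The numeric
  arguments of the instructions are memory addresses, except for the constant in
  \<open>LoadConst\<close> and the jump targets.\<close>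

datatype instr =
    LoadConst nat nat
  | Add nat nat nat
  | Sub nat nat nat
  | Load nat nat
  | Store nat nat
  | Jump nat
  | JumpIfZero nat nat
  | SetProb nat nat nat
  | Query nat
  | NewClause
  | EmitPos nat
  | EmitNeg nat
  | Halt

type_synonym program = "instr list"

record config =
  pc :: nat
  mem :: "nat \<Rightarrow> nat"
  qarr :: "nat \<Rightarrow> real"
  outp :: formula

definition set_mem :: "nat \<Rightarrow> nat \<Rightarrow> config \<Rightarrow> config" where
  "set_mem d v s = s\<lparr>pc := Suc (pc s), mem := (mem s)(d := v)\<rparr>"

fun emit :: "literal \<Rightarrow> config \<Rightarrow> config set" where
  "emit l s = (case outp s of
       [] \<Rightarrow> {}
     | c # cs \<Rightarrow> {s\<lparr>pc := Suc (pc s), outp := insert l c # cs\<rparr>})"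

text \<open>The possible successor configurations; there are several only for \<open>Query\<close>, one for
  each admissible answer. An illegal operation (a zero denominator, a query that is not a
  probabilistic assignment, a literal emitted before the first clause is opened) has no
  successor, and neither has \<open>Halt\<close>. The formula \<open>F\<close> is the hidden one; only \<open>Query\<close>
  depends on it.\<close>

fun exec :: "nat \<Rightarrow> formula \<Rightarrow> instr \<Rightarrow> config \<Rightarrow> config set" where
  "exec n F (LoadConst d k) s = {set_mem d k s}"
| "exec n F (Add d p q) s = {set_mem d (mem s p + mem s q) s}"
| "exec n F (Sub d p q) s = {set_mem d (mem s p - mem s q) s}"
| "exec n F (Load d p) s = {set_mem d (mem s (mem s p)) s}"
| "exec n F (Store d p) s = {set_mem (mem s d) (mem s p) s}"
| "exec n F (Jump t) s = {s\<lparr>pc := t\<rparr>}"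
| "exec n F (JumpIfZero p t) s = {s\<lparr>pc := (if mem s p = 0 then t else Suc (pc s))\<rparr>}"
| "exec n F (SetProb i p q) s =
     (if mem s q = 0 then {}
      else {s\<lparr>pc := Suc (pc s),
              qarr := (qarr s)(mem s i := real (mem s p) / real (mem s q))\<rparr>})"
| "exec n F (Query d) s =
     (if prob_assignment n (qarr s) then {set_mem d j s | j. oracle_answer F (qarr s) j}
      else {})"
| "exec n F NewClause s = {s\<lparr>pc := Suc (pc s), outp := {} # outp s\<rparr>}"
| "exec n F (EmitPos p) s = emit (Pos (mem s p)) s"
| "exec n F (EmitNeg p) s = emit (Neg (mem s p)) s"
| "exec n F Halt s = {}"

definition step :: "program \<Rightarrow> nat \<Rightarrow> formula \<Rightarrow> config \<Rightarrow> config \<Rightarrow> bool" where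
  "step P n F s s' \<longleftrightarrow> pc s < length P \<and> s' \<in> exec n F (P ! pc s) s"

definition halted :: "program \<Rightarrow> config \<Rightarrow> bool" where
  "halted P s \<longleftrightarrow> pc s < length P \<and> P ! pc s = Halt"

text \<open>The only input is the number \<open>n\<close> of variables, in memory cell \<open>0\<close>.\<close>

definition init :: "nat \<Rightarrow> config" where
  "init n = \<lparr>pc = 0, mem = (\<lambda>_. 0)(0 := n), qarr = (\<lambda>_. 0), outp = []\<rparr>"

text \<open>Whatever the oracle's choices, which may depend on the whole run so far, the run has at
  most \<open>t\<close> steps and ends at \<open>Halt\<close>, with a SAT formula equivalent to \<open>F\<close> as output.\<close>

definition learns_within :: "program \<Rightarrow> nat \<Rightarrow> formula \<Rightarrow> nat \<Rightarrow> bool" where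
  "learns_within P n F t \<longleftrightarrow>
     (\<forall>k s. (step P n F ^^ k) (init n) s \<longrightarrow>
        k \<le> t \<and>
        ((\<nexists>s'. step P n F s s') \<longrightarrow>
           halted P s \<and> sat_formula n (outp s) \<and> equivalent F (outp s)))"

end

theory Submission
  imports Defs
begin

text \<open>A wide clause is violated at exactly one point of the cube. Querying 0 or 1 on the variables
  \<open>1, \<dots>, k\<close> and 1/2 on the others tells whether a subcube contains such a point, so a depth-first
  search that leaves empty subcubes at once visits at most \<open>2 m n + 1\<close> subcubes, and the hidden
  clauses are recovered verbatim in time \<open>O(m n + n + 1)\<close>. This suffices, because
  \<open>n choose (m - 1) \<ge> n\<close> for \<open>2 \<le> m \<le> n\<close>.\<close>

section \<open>Reasoning about all runs of a program\<close>

text \<open>\<open>learns_within\<close> from an arbitrary configuration, so that the claim can be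
  passed from one configuration to its successors.\<close>

definition safe :: "program \<Rightarrow> nat \<Rightarrow> formula \<Rightarrow> nat \<Rightarrow> config \<Rightarrow> bool" where
  "safe P n F t s \<longleftrightarrow>
     (\<forall>k s'. (step P n F ^^ k) s s' \<longrightarrow>
        k \<le> t \<and>
        ((\<nexists>s''. step P n F s' s'') \<longrightarrow>
           halted P s' \<and> sat_formula n (outp s') \<and> equivalent F (outp s')))"

lemma learns_within_iff_safe: "learns_within P n F t \<longleftrightarrow> safe P n F t (init n)"
  by (simp add: learns_within_def safe_def)

lemma safe_mono: "safe P n F t s \<Longrightarrow> t \<le> t' \<Longrightarrow> safe P n F t' s"
  unfolding safe_def by (meson order_trans)

text \<open>Any longer run splits off its first step, and the nonempty successor set keeps the run
  from getting stuck here. As an equivalence it serves \<open>simp\<close> for symbolic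
  execution.\<close>

lemma safe_step:
  assumes "0 < t" "pc s < length P" "exec n F (P ! pc s) s \<noteq> {}"
  shows "safe P n F t s \<longleftrightarrow> (\<forall>s'\<in>exec n F (P ! pc s) s. safe P n F (t - 1) s')"
proof
  have *: "step P n F s s' \<longleftrightarrow> s' \<in> exec n F (P ! pc s) s" for s'
    using assms(2) by (simp add: step_def)
  show "\<forall>s'\<in>exec n F (P ! pc s) s. safe P n F (t - 1) s'" if "safe P n F t s"
  proof
    fix s' assume s': "s' \<in> exec n F (P ! pc s) s"
    show "safe P n F (t - 1) s'"
      unfolding safe_def
    proof (intro allI impI)
      fix k s'' assume "(step P n F ^^ k) s' s''"
      then have "(step P n F ^^ Suc k) s s''"
        using s' * by (intro relpowp_Suc_I2) auto
      then show "k \<le> t - 1 \<and> ((\<nexists>u. step P n F s'' u) \<longrightarrow>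
          halted P s'' \<and> sat_formula n (outp s'') \<and> equivalent F (outp s''))"
        using that unfolding safe_def by fastforce
    qed
  qed
  assume R: "\<forall>s'\<in>exec n F (P ! pc s) s. safe P n F (t - 1) s'"
  show "safe P n F t s"
    unfolding safe_def
  proof (intro allI impI)
    fix k s'' assume k: "(step P n F ^^ k) s s''"
    show "k \<le> t \<and> ((\<nexists>u. step P n F s'' u) \<longrightarrow>
        halted P s'' \<and> sat_formula n (outp s'') \<and> equivalent F (outp s''))"
    proof (cases k)
      case 0
      then show ?thesis using k * assms(3) by auto
    next
      case (Suc k')
      then obtain s' where "step P n F s s'" "(step P n F ^^ k') s' s''"
        using k relpowp_Suc_D2 by metis
      then have "k' \<le> t - 1 \<and> ((\<nexists>u. step P n F s'' u) \<longrightarrow>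
          halted P s'' \<and> sat_formula n (outp s'') \<and> equivalent F (outp s''))"
        using R * unfolding safe_def by blast
      then show ?thesis using Suc assms(1) by auto
    qed
  qed
qed

lemma safe_halted:
  assumes "halted P s" "sat_formula n (outp s)" "equivalent F (outp s)"
  shows "safe P n F t s"
  unfolding safe_def
proof (intro allI impI)
  fix k s' assume k: "(step P n F ^^ k) s s'"
  have *: "\<not> step P n F s u" for u
    using assms(1) by (auto simp: halted_def step_def)
  then have "k = 0"
    using k relpowp_Suc_D2 by (metis not0_implies_Suc)
  then show "k \<le> t \<and> ((\<nexists>u. step P n F s' u) \<longrightarrow>
      halted P s' \<and> sat_formula n (outp s') \<and> equivalent F (outp s'))"
    using k assms by auto
qed

section \<open>The search program\<close>

text \<open>Cells: 0 holds \<open>n\<close>; 1, 2, 3 the constants 1, 2, 8; 4 the depth \<open>k\<close>; 5 an address; 6 a value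
  or the oracle's answer; 7 the loop counter of the output; \<open>8 + i\<close> the branch taken at
  variable \<open>i\<close>. The branch 1 is explored before the branch 0. The dummy variable 0 is a sentinel:
  the program starts by backtracking from depth \<open>n\<close>, which sets all probabilities to 1/2, and
  changing the branch of the variable 0 then starts the search.\<close>

definition learner :: program where
  "learner =
    [LoadConst 1 1,
     LoadConst 2 2,
     LoadConst 3 8,
     Add 4 0 6,
     Store 3 1,
     \<comment> \<open>5: backtrack\<close>
     Add 5 3 4,
     Load 6 5,
     JumpIfZero 6 12,
     LoadConst 6 0,
     Store 5 6,
     SetProb 4 6 1,
     Jump 16,
     \<comment> \<open>12: both branches are done\<close>
     SetProb 4 1 2,
     JumpIfZero 4 25,
     Sub 4 4 1,
     Jump 5,
     \<comment> \<open>16: explore the current subcube\<close>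
     Query 6,
     JumpIfZero 6 5,
     Sub 6 0 4,
     JumpIfZero 6 26,
     Add 4 4 1,
     Add 5 3 4,
     Store 5 1,
     SetProb 4 1 1,
     Jump 16,
     Halt,
     \<comment> \<open>26: output the clause violated at the current point\<close>
     NewClause,
     Add 7 0 6,
     JumpIfZero 7 5,
     Add 5 3 7,
     Load 6 5,
     JumpIfZero 6 35,
     EmitNeg 7,
     Sub 7 7 1,
     Jump 28,
     EmitPos 7,
     Sub 7 7 1,
     Jump 28]"

section \<open>Clauses violated in a subcube\<close>

definition false_lit :: "(nat \<Rightarrow> nat) \<Rightarrow> nat \<Rightarrow> literal" where
  "false_lit b i = (if b i = 0 then Pos i else Neg i)"

lemma var_false_lit [simp]: "var (false_lit b i) = i"
  by (simp add: false_lit_def)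

text \<open>For a wide clause, membership says that its unique falsifying point lies in the subcube
  where the variables 1 to \<open>k\<close> are fixed to \<open>b\<close>.\<close>

definition violated_on :: "formula \<Rightarrow> (nat \<Rightarrow> nat) \<Rightarrow> nat \<Rightarrow> clause set" where
  "violated_on F b k = {c \<in> set F. \<forall>i\<in>{1..k}. false_lit b i \<in> c}"

lemma finite_violated_on [simp]: "finite (violated_on F b k)"
  by (simp add: violated_on_def)

lemma wide_clause_literal:
  assumes "wide_clause n c" "i \<in> {1..n}"
  shows "Pos i \<in> c \<longleftrightarrow> Neg i \<notin> c"
proof -
  have inj: "inj_on var c" and "i \<in> var ` c"
    using assms by (auto simp: wide_clause_def sat_clause_def)
  then obtain l where "l \<in> c" "var l = i" by auto
  moreover from this have "l = Pos i \<or> l = Neg i" by (cases l) auto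
  ultimately have "Pos i \<in> c \<or> Neg i \<in> c" by auto
  moreover have "\<not> (Pos i \<in> c \<and> Neg i \<in> c)"
    using inj_onD[OF inj, of "Pos i" "Neg i"] by auto
  ultimately show ?thesis by blast
qed

lemma wide_clause_finite: "wide_clause n c \<Longrightarrow> finite c"
  by (auto simp: wide_clause_def sat_clause_def intro: finite_imageD[of var])

text \<open>A wide clause contains exactly one of the two literals on the variable
  \<open>Suc k\<close>, which decides the half it belongs to.\<close>

lemma violated_on_split:
  assumes "widesat n F" "k < n"
  shows "violated_on F b k =
      violated_on F (b(Suc k := 1)) (Suc k) \<union> violated_on F (b(Suc k := 0)) (Suc k)" (is ?union)
    and "violated_on F (b(Suc k := 1)) (Suc k) \<inter> violated_on F (b(Suc k := 0)) (Suc k) = {}" (is ?disj)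
proof -
  have w: "Pos (Suc k) \<in> c \<longleftrightarrow> Neg (Suc k) \<notin> c" if "c \<in> set F" for c
    using wide_clause_literal[of n c "Suc k"] that assms by (auto simp: widesat_def)
  show ?union ?disj
    using w by (auto simp: violated_on_def false_lit_def atLeastAtMostSuc_conv)
qed

text \<open>By injectivity of \<open>var\<close>, a second literal on any variable is impossible, so
  the \<open>n\<close> prescribed literals exhaust the clause.\<close>

lemma violated_on_full:
  assumes "widesat n F" "c \<in> violated_on F b n"
  shows "c = false_lit b ` {1..n}"
proof -
  have "wide_clause n c" and sub: "false_lit b ` {1..n} \<subseteq> c"
    using assms by (auto simp: violated_on_def widesat_def)
  then have inj: "inj_on var c" and vars: "var ` c = {1..n}"
    by (auto simp: wide_clause_def sat_clause_def)
  have "l \<in> false_lit b ` {1..n}" if "l \<in> c" for l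
  proof -
    have v: "var l \<in> {1..n}" using that vars by blast
    then have "false_lit b (var l) = l"
      using inj_onD[OF inj, of "false_lit b (var l)" l] that sub by (auto simp: image_subset_iff)
    with v show ?thesis by (metis imageI)
  qed
  with sub show ?thesis by blast
qed

text \<open>The product vanishes iff a factor does. A free variable contributes 1/2, and a fixed one
  contributes 0 exactly when the clause has the literal opposite to
  \<open>false_lit b i\<close>.\<close>

lemma violation_prob_eq_0_iff:
  assumes c: "c \<in> set F" "widesat n F" and "k \<le> n"
    and b: "\<And>i. i \<in> {1..k} \<Longrightarrow> b i \<le> 1"
    and q: "\<And>i. i \<in> {1..k} \<Longrightarrow> q i = real (b i)" "\<And>i. i \<in> {k<..n} \<Longrightarrow> q i = 1/2"
  shows "violation_prob q c = 0 \<longleftrightarrow> c \<notin> violated_on F b k"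
proof -
  have w: "wide_clause n c" using c by (simp add: widesat_def)
  have "violation_prob q c = 0 \<longleftrightarrow> (\<exists>l\<in>c. prob_false q l = 0)"
    using wide_clause_finite[OF w] by (simp add: violation_prob_def)
  also have "\<dots> \<longleftrightarrow> (\<exists>i\<in>{1..k}. false_lit b i \<notin> c)"
  proof
    assume "\<exists>l\<in>c. prob_false q l = 0"
    then obtain l where l: "l \<in> c" "prob_false q l = 0" by blast
    have v: "var l \<in> {1..n}" using l(1) w by (auto simp: wide_clause_def)
    have vk: "var l \<in> {1..k}"
    proof (rule ccontr)
      assume "var l \<notin> {1..k}"
      with v have "q (var l) = 1/2" using q(2) by auto
      with l(2) show False by (cases l) auto
    qed
    have "false_lit b (var l) \<notin> c"
      using l v q(1)[OF vk] wide_clause_literal[OF w v]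
      by (cases l) (auto simp: false_lit_def split: if_splits)
    with vk show "\<exists>i\<in>{1..k}. false_lit b i \<notin> c" by blast
  next
    assume "\<exists>i\<in>{1..k}. false_lit b i \<notin> c"
    then obtain i where i: "i \<in> {1..k}" "false_lit b i \<notin> c" by blast
    have v: "i \<in> {1..n}" using i(1) \<open>k \<le> n\<close> by auto
    have b': "b i = 0 \<or> b i = 1" using b[OF i(1)] by linarith
    show "\<exists>l\<in>c. prob_false q l = 0"
    proof (cases "b i = 0")
      case True
      then have "Neg i \<in> c" using i(2) wide_clause_literal[OF w v] by (auto simp: false_lit_def)
      then show ?thesis using q(1)[OF i(1)] True by force
    next
      case False
      then have "Pos i \<in> c" using i(2) wide_clause_literal[OF w v] by (auto simp: false_lit_def)
      then show ?thesis using q(1)[OF i(1)] False b' by force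
    qed
  qed
  finally show ?thesis using c by (auto simp: violated_on_def)
qed

section \<open>Invariant and program fragments\<close>

text \<open>The search invariant: program counter \<open>l\<close>, depth \<open>k\<close>, branches
  \<open>b\<close>, output clauses \<open>G\<close>. The branches include the sentinel 0; the
  conditions on \<open>qarr\<close> start at 1, since the probability of the variable 0 affects no
  query on a wide formula.\<close>

definition at_node ::
    "nat \<Rightarrow> nat \<Rightarrow> nat \<Rightarrow> (nat \<Rightarrow> nat) \<Rightarrow> clause set \<Rightarrow> config \<Rightarrow> bool" where
  "at_node n l k b G s \<longleftrightarrow>
     pc s = l \<and> mem s 0 = n \<and> mem s 1 = 1 \<and> mem s 2 = 2 \<and> mem s 3 = 8 \<and> mem s 4 = k \<and>
     k \<le> n \<and> (\<forall>i\<le>k. mem s (8 + i) = b i \<and> b i \<le> 1) \<and>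
     (\<forall>i\<in>{1..k}. qarr s i = real (b i)) \<and> (\<forall>i\<in>{k<..n}. qarr s i = 1/2) \<and>
     set (outp s) = G"

text \<open>The \<open>arg_cong\<close> instances evaluate \<open>length learner\<close> and
  \<open>learner ! i\<close> while \<open>learner\<close> itself stays folded in the goals.\<close>

lemmas exec_learner = safe_step set_mem_def
  arg_cong[OF learner_def, of length] arg_cong[OF learner_def, of "\<lambda>P. P ! i" for i]

text \<open>The lemmas on program fragments are in continuation-passing style: if the configurations
  reached at the end of the fragment are \<^const>\<open>safe\<close> with \<open>t\<close> steps, so is the initial one with
  \<open>t\<close> plus the length of the fragment.\<close>

lemma at_node_flip:
  assumes s: "at_node n 5 k b G s" and bk: "b k = 1"
    and cont: "\<And>s'. at_node n 16 k (b(k := 0)) G s' \<Longrightarrow> safe learner n F t s'"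
  shows "safe learner n F (t + 7) s"
  using s bk
  apply (cases s)
  apply (simp add: at_node_def exec_learner)
  apply (rule cont)
  apply (auto simp: at_node_def)
  done

lemma at_node_up:
  assumes s: "at_node n 5 (Suc k) b G s" and bk: "b (Suc k) = 0"
    and cont: "\<And>s'. at_node n 5 k b G s' \<Longrightarrow> safe learner n F t s'"
  shows "safe learner n F (t + 7) s"
proof -
  have "mem s (8 + Suc k) = b (Suc k)"
    using s unfolding at_node_def by blast
  then show ?thesis
    using s bk
    apply (cases s)
    apply (simp add: at_node_def exec_learner)
    apply (rule cont)
    apply (auto simp: at_node_def)
    done
qed

lemma at_node_end:
  assumes s: "at_node n 5 0 b (set F) s" and bk: "b 0 = 0" and F: "widesat n F"
  shows "safe learner n F 5 s"
  using s bk
  apply (cases s)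
  apply (simp add: at_node_def exec_learner)
  apply (rule safe_halted)
  using F
  apply (auto simp: halted_def exec_learner sat_formula_def widesat_def wide_clause_def equivalent_def satisfies_def)
  done

text \<open>The counter runs down from \<open>i\<close> to 1, with 7 steps per literal and one for
  the exit. \<open>G\<close> is arbitrary because the head clause of the output is still
  growing.\<close>

lemma at_node_emit_loop:
  assumes "at_node n 28 n b G s" "mem s 7 = i" "i \<le> n" "outp s = c # cs"
    and "\<And>s'. at_node n 5 n b (insert (c \<union> false_lit b ` {1..i}) (set cs)) s' \<Longrightarrow>
      safe learner n F t s'"
  shows "safe learner n F (t + 7 * i + 1) s"
  using assms
proof (induction i arbitrary: s c G)
  case 0
  then show ?case
    apply (cases s)
    apply (simp add: at_node_def exec_learner)
    done
next
  case (Suc i)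
  define t' where "t' = t + 7 * i + 1"  \<comment> \<open>opaque, so that symbolic execution stops after one iteration\<close>
  have IH: "safe learner n F t' s'"
    if "at_node n 28 n b G' s'" "mem s' 7 = i" "outp s' = insert (false_lit b (Suc i)) c # cs"
    for s' G'
    using Suc.prems(3,5) that unfolding t'_def
    by (intro Suc.IH[of G' s' "insert (false_lit b (Suc i)) c"]) (auto simp: atLeastAtMostSuc_conv)
  have "mem s (8 + Suc i) = b (Suc i)"
    using Suc.prems(1,3) unfolding at_node_def by blast
  then have "safe learner n F (t' + 7) s"
    using Suc.prems(1-4)
    apply (cases s)
    apply (simp add: at_node_def exec_learner)
    apply (intro conjI impI; rule IH[simplified])
    apply (auto simp: at_node_def false_lit_def)
    done
  then show ?case by (simp add: t'_def algebra_simps)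
qed

text \<open>Needed so that a query always has a successor: a maximum over finitely many clauses is
  attained.\<close>

lemma oracle_answer_exists: "\<exists>j. oracle_answer F a j"
proof (cases "\<forall>c\<in>set F. violation_prob a c = 0")
  case True
  then show ?thesis by (auto simp: oracle_answer_def)
next
  case False
  then have "violation_prob a ` set F \<noteq> {}" by auto
  then obtain c where c: "c \<in> set F" "violation_prob a c = Max (violation_prob a ` set F)"
    using Max_in[of "violation_prob a ` set F"] by (metis finite_imageI finite_set imageE)
  then obtain i where "i < length F" "F ! i = c" by (auto simp: in_set_conv_nth)
  then have "oracle_answer F a (Suc i)"
    using False c by (auto simp: oracle_answer_def)
  then show ?thesis ..
qed

lemma at_node_query:
  assumes s: "at_node n 16 k b G s" and F: "widesat n F"
    and cont: "\<And>s'. at_node n 17 k b G s' \<Longrightarrow> mem s' 6 = 0 \<longleftrightarrow> violated_on F b k = {} \<Longrightarrow>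
      safe learner n F t s'"
  shows "safe learner n F (t + 1) s"
proof -
  have pa: "prob_assignment n (qarr s)"
    unfolding prob_assignment_def
  proof
    fix i assume "i \<in> {1..n}"
    then consider "i \<in> {1..k}" | "i \<in> {k<..n}" by fastforce
    then show "0 \<le> qarr s i \<and> qarr s i \<le> 1"
    proof cases
      case 1
      then show ?thesis using s by (auto simp: at_node_def)
    next
      case 2
      then have "qarr s i = 1/2" using s unfolding at_node_def by blast
      then show ?thesis by simp
    qed
  qed
  have "violation_prob (qarr s) c = 0 \<longleftrightarrow> c \<notin> violated_on F b k" if "c \<in> set F" for c
    using that F s by (intro violation_prob_eq_0_iff) (auto simp: at_node_def)
  then have ans: "j = 0 \<longleftrightarrow> violated_on F b k = {}" if "oracle_answer F (qarr s) j" for j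
    using that by (auto simp: oracle_answer_def violated_on_def split: if_splits)
  show ?thesis
    using s pa ans oracle_answer_exists[of F "qarr s"]
    apply (simp add: at_node_def exec_learner)
    apply (intro allI impI)
    apply (erule exE)
    apply (rule cont)
    apply (auto simp: at_node_def)
    done
qed

lemma at_node_empty:
  assumes s: "at_node n 17 k b G s" and "mem s 6 = 0"
    and cont: "\<And>s'. at_node n 5 k b G s' \<Longrightarrow> safe learner n F t s'"
  shows "safe learner n F (t + 1) s"
  using assms(1,2)
  apply (cases s)
  apply (simp add: at_node_def exec_learner)
  apply (rule cont)
  apply (auto simp: at_node_def)
  done

lemma at_node_down:
  assumes s: "at_node n 17 k b G s" and "mem s 6 \<noteq> 0" "k < n"
    and cont: "\<And>s'. at_node n 16 (Suc k) (b(Suc k := 1)) G s' \<Longrightarrow> safe learner n F t s'"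
  shows "safe learner n F (t + 8) s"
  using assms(1-3)
  apply (cases s)
  apply (simp add: at_node_def exec_learner)
  apply (rule cont)
  apply (auto simp: at_node_def)
  done

lemma at_node_emit:
  assumes s: "at_node n 17 n b G s" and "mem s 6 \<noteq> 0"
    and cont: "\<And>s'. at_node n 5 n b (insert (false_lit b ` {1..n}) G) s' \<Longrightarrow>
      safe learner n F t s'"
  shows "safe learner n F (t + 7 * n + 6) s"
proof -
  define t' where "t' = t + 7 * n + 1"
  have loop: "safe learner n F t' s'"
    if "at_node n 28 n b (insert {} G) s'" "mem s' 7 = n" "outp s' = {} # outp s" for s'
    using s cont that(2,3) unfolding t'_def by (intro at_node_emit_loop[OF that(1)]) (auto simp: at_node_def)
  have "safe learner n F (t' + 5) s"
    using assms(1,2)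
    apply (cases s)
    apply (simp add: at_node_def exec_learner)
    apply (rule loop[simplified])
    apply (auto simp: at_node_def)
    done
  then show ?thesis by (simp add: t'_def algebra_simps)
qed

section \<open>Depth-first search and its running time\<close>

text \<open>An empty subcube costs 2 steps. Otherwise each clause in it pays 25 steps for every
  level below and \<open>7 * n + 5\<close> for its output.\<close>

lemma at_node_search:
  assumes "at_node n 16 k b G s" "widesat n F"
    and "\<And>s'. at_node n 5 k b (G \<union> violated_on F b k) s' \<Longrightarrow> safe learner n F t s'"
  shows "safe learner n F (t + 2 + card (violated_on F b k) * (25 * (n - k) + 7 * n + 5)) s"
  using assms
proof (induction "n - k" arbitrary: k b G s t)
  case 0
  then have k: "k = n" by (auto simp: at_node_def)
  show ?case
  proof (cases "violated_on F b k = {}")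
    case True
    have "safe learner n F (t + 1 + 1) s"
      using 0 True by (intro at_node_query[OF 0(2,3)] at_node_empty) auto
    then show ?thesis using True by simp
  next
    case False
    then have "violated_on F b n = {false_lit b ` {1..n}}"
      using violated_on_full[OF 0(3), of _ b] k by blast
    moreover have "safe learner n F (t + 7 * n + 6 + 1) s"
      using 0(4) False k calculation
      by (intro at_node_query[OF 0(2,3)]) (auto intro: at_node_emit)
    ultimately show ?thesis using k by (simp add: algebra_simps)
  qed
next
  case (Suc d)
  then have k: "k < n" and d: "d = n - Suc k" by auto
  show ?case
  proof (cases "violated_on F b k = {}")
    case True
    have "safe learner n F (t + 1 + 1) s"
      using Suc True by (intro at_node_query[OF Suc(3,4)] at_node_empty) auto
    then show ?thesis using True by simp
  next
    case False
    let ?b1 = "b(Suc k := 1)" and ?b0 = "b(Suc k := 0)"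
    let ?V1 = "violated_on F ?b1 (Suc k)" and ?V0 = "violated_on F ?b0 (Suc k)"
    let ?C = "25 * (n - Suc k) + 7 * n + 5"
    note split = violated_on_split[OF Suc(4) k, of b]
    have card: "card (violated_on F b k) = card ?V1 + card ?V0"
      using split by (simp add: card_Un_disjoint)
    \<comment> \<open>Each phase needs the next as its continuation, so the phases appear in reverse
      order of execution: \<open>left\<close>, \<open>flip\<close>, \<open>right\<close>,
      \<open>up\<close>.\<close>
    have up: "safe learner n F (t + 7) s'"
      if "at_node n 5 (Suc k) ?b0 (G \<union> ?V1 \<union> ?V0) s'" for s'
    proof (rule at_node_up[OF that])
      fix s'' assume "at_node n 5 k ?b0 (G \<union> ?V1 \<union> ?V0) s''"
      then have "at_node n 5 k b (G \<union> violated_on F b k) s''"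
        unfolding split(1) by (auto simp: at_node_def)
      then show "safe learner n F t s''" by (rule Suc(5))
    qed simp
    have right: "safe learner n F (t + 7 + 2 + card ?V0 * ?C) s'"
      if "at_node n 16 (Suc k) ?b0 (G \<union> ?V1) s'" for s'
      by (rule Suc.hyps(1)[OF d that Suc(4) up])
    have flip: "safe learner n F (t + 7 + 2 + card ?V0 * ?C + 7) s'"
      if "at_node n 5 (Suc k) ?b1 (G \<union> ?V1) s'" for s'
    proof (rule at_node_flip[OF that])
      fix s'' assume "at_node n 16 (Suc k) (?b1(Suc k := 0)) (G \<union> ?V1) s''"
      then show "safe learner n F (t + 7 + 2 + card ?V0 * ?C) s''"
        unfolding fun_upd_upd by (rule right)
    qed simp
    have left: "safe learner n F (t + 7 + 2 + card ?V0 * ?C + 7 + 2 + card ?V1 * ?C) s'"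
      if "at_node n 16 (Suc k) ?b1 G s'" for s'
      by (rule Suc.hyps(1)[OF d that Suc(4) flip])
    have "safe learner n F (t + 7 + 2 + card ?V0 * ?C + 7 + 2 + card ?V1 * ?C + 8 + 1) s"
    proof (rule at_node_query[OF Suc(3,4)])
      fix s' assume "at_node n 17 k b G s'" "mem s' 6 = 0 \<longleftrightarrow> violated_on F b k = {}"
      with False k left
      show "safe learner n F (t + 7 + 2 + card ?V0 * ?C + 7 + 2 + card ?V1 * ?C + 8) s'"
        by (intro at_node_down) blast+
    qed
    moreover have "t + 7 + 2 + card ?V0 * ?C + 7 + 2 + card ?V1 * ?C + 8 + 1
        \<le> t + 2 + card (violated_on F b k) * (25 * (n - k) + 7 * n + 5)"
    \<comment> \<open>The node itself and its two base costs take 27 steps; 2 are in the budget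
      already, and the other 25 are charged to a clause, of which there is at least one.\<close>
    proof -
      have "25 * (n - k) + 7 * n + 5 = ?C + 25" using k by simp
      then have "card (violated_on F b k) * (25 * (n - k) + 7 * n + 5) =
          card ?V0 * ?C + card ?V1 * ?C + 25 * card (violated_on F b k)"
        unfolding card by (simp only: distrib_left distrib_right mult.commute add_ac)
      moreover have "1 \<le> card (violated_on F b k)"
        using False by (simp add: Suc_le_eq card_gt_0_iff)
      ultimately show ?thesis by linarith
    qed
    ultimately show ?thesis by (rule safe_mono)
  qed
qed

text \<open>All branches except the sentinel's read as finished, so the program climbs to depth 0,
  setting probabilities to 1/2, and flips the sentinel. There the subcube is the whole cube, with
  cost \<open>25 * n + 7 * n + 5\<close> per clause.\<close>

lemma at_node_root:
  assumes "at_node n 5 k ((\<lambda>_. 0)(0 := 1)) {} s" "widesat n F"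
  shows "safe learner n F (5 + 2 + card (set F) * (32 * n + 5) + 7 + 7 * k) s"
  using assms(1)
proof (induction k arbitrary: s)
  case 0
  have search: "safe learner n F (5 + 2 + card (set F) * (32 * n + 5)) s'"
    if "at_node n 16 0 (\<lambda>_. 0) {} s'" for s'
    using at_node_search[OF that assms(2), of 5] at_node_end[OF _ _ assms(2)]
    by (simp add: violated_on_def)
  have "((\<lambda>_. 0)(0 := 1))(0 := 0) = (\<lambda>_::nat. 0::nat)" by auto
  then have "safe learner n F (5 + 2 + card (set F) * (32 * n + 5) + 7) s"
    using search by (intro at_node_flip[OF 0]) (simp_all only: fun_upd_same)
  then show ?case by simp
next
  case (Suc k)
  have "safe learner n F (5 + 2 + card (set F) * (32 * n + 5) + 7 + 7 * k + 7) s"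
    by (rule at_node_up[OF Suc.prems _ Suc.IH]) simp_all
  then show ?case by (simp add: algebra_simps)
qed

lemma safe_init:
  assumes "\<And>s. at_node n 5 n ((\<lambda>_. 0)(0 := 1)) {} s \<Longrightarrow> safe learner n F t s"
  shows "safe learner n F (t + 5) (init n)"
  apply (simp add: init_def exec_learner)
  apply (rule assms)
  apply (auto simp: at_node_def)
  done

section \<open>Comparison with the binomial bound\<close>

lemma self_le_choose: "0 < k \<Longrightarrow> k < n \<Longrightarrow> n \<le> n choose k"
proof (induction n arbitrary: k)
  case 0
  then show ?case by simp
next
  case (Suc n)
  then obtain j where j: "k = Suc j" using gr0_implies_Suc by blast
  show ?case
  proof (cases "k = n")
    case True
    then show ?thesis by simp
  next
    case False
    then have "n \<le> n choose k" using Suc by simp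
    moreover have "0 < n choose j" using Suc.prems j by (simp add: zero_less_binomial)
    ultimately show ?thesis unfolding j binomial_Suc_Suc by linarith
  qed
qed

lemma le_choose_mult_power:
  assumes "m \<le> n"
  shows "m * n + 1 \<le> 2 * ((n choose (m - 1)) * 2 ^ m + n)"
\<comment> \<open>For \<open>m = 0\<close> truncated subtraction makes the binomial coefficient 1,
  which covers the summand 1 even when \<open>n = 0\<close>.\<close>
proof (cases "m \<le> 1")
  case True
  then show ?thesis by (cases m) auto
next
  case False
  then have "n \<le> n choose (m - 1)"
    using assms by (intro self_le_choose) auto
  then have "n * m \<le> (n choose (m - 1)) * 2 ^ m"
    by (intro mult_mono) auto
  moreover have "1 \<le> n" using False assms by simp
  ultimately show ?thesis by (simp add: mult.commute)
qed

theorem proposition1: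
  "\<exists>(P :: program) (C :: nat). \<forall>(n :: nat) (m :: nat) (F :: formula).
     widesat n F \<and> distinct F \<and> length F = m \<and> m \<le> n \<longrightarrow>
     learns_within P n F (C * ((n choose (m - 1)) * 2 ^ m + n))"
proof (intro exI allI impI)
  fix n m F
  assume F: "widesat n F \<and> distinct F \<and> length F = m \<and> m \<le> n"
  then have card: "card (set F) = m" by (auto simp: distinct_card)
  define B where "B = (n choose (m - 1)) * 2 ^ m + n"
  have "m * n + 1 \<le> 2 * B" using F unfolding B_def by (intro le_choose_mult_power) auto
  moreover have "m \<le> B" "n \<le> B" using F by (auto simp: B_def)
  moreover have "24 + 7 * n + m * (32 * n + 5) = 24 + 7 * n + 32 * (m * n) + 5 * m"
    by (simp add: algebra_simps)
  \<comment> \<open>The constant is 76 = 32 * 2 + 7 + 5, and 24 is absorbed by the 32 in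
    \<open>32 * (m * n + 1)\<close>.\<close>
  ultimately have "24 + 7 * n + m * (32 * n + 5) \<le> 76 * B"
    by linarith
  moreover have "safe learner n F (5 + 2 + m * (32 * n + 5) + 7 + 7 * n + 5) (init n)"
    using at_node_root F unfolding card[symmetric] by (intro safe_init) blast
  ultimately have "safe learner n F (76 * B) (init n)"
    by (auto elim: safe_mono)
  then show "learns_within learner n F (76 * ((n choose (m - 1)) * 2 ^ m + n))"
    by (simp add: learns_within_iff_safe B_def)
qed

end
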